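(* Let $n\ge 6$. (a) The thresholds are strictly decreasing in $k$: $r_{k+1}(n)<r_k(n)$ for $1\le k\le\lfloor n/2\rfloor-2$. (b) For every fixed $k\ge 1$, $\lim_{n\to\infty} r_k(n)=1$ (where $n$ ranges over integers with $n\ge 6$ and $k\le\lfloor n/2\rfloor-1$).
   Context: For an integer $n\ge 2$ let $N=\binom{n}{2}$. The edges $(i,j)$, $1\le i<j\le n$, of $K_n$ are ordered lexicographically $(1,2),(1,3),\dots,(1,n),(2,3),\dots,(n-1,n)$; $(i,j)$ has index $\mathrm{idx}(i,j)=(i-1)n-\binom{i}{2}+(j-i)$. For a binary string $\mathbf{x}=(x_1,\dots,x_n)$, the cut vector $\delta(\mathbf{x})\in\{0,1\}^N$ has entry $1$ at position $\mathrm{idx}(i,j)$ iff $x_i\ne x_j$. For $\delta\in\{0,1\}^N$ and real $r$, $W^n(\delta;r)=\sum_{i=1}^N\delta_i r^{N-i}$. For $1\le k\le n$, $C_k=\delta(1^k0^{n-k})$ ($k$ ones followed by $n-k$ zeros). For $1\le k\le n-1$, $P^{n,k}(r)=W^n(C_k;r)-W^n(C_{k+1};r)$. For $n\ge 6$ and $1\le k\le\lfloor n/2\rfloor-1$, the polynomial $P^{n,k}$ has exactly one root in $(1,2)$, denoted $r_k(n)$. *)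

theory Defs
  imports "HOL-Analysis.Analysis"
begin

text \<open>Binary strings of length \<open>n\<close> and vectors of length \<open>n choose 2\<close> are functions on
  \<open>nat\<close>, read at the positions \<open>1..n\<close> and \<open>1..n choose 2\<close> only.\<close>

text \<open>The subtraction is never truncated on edges: \<open>i choose 2 \<le> (i - 1) * n\<close> if \<open>1 \<le> i \<le> n\<close>.\<close>

definition edge_idx :: "nat \<Rightarrow> nat \<Rightarrow> nat \<Rightarrow> nat" where
  "edge_idx n i j = (i - 1) * n - (i choose 2) + (j - i)"

definition cut_vector :: "nat \<Rightarrow> (nat \<Rightarrow> nat) \<Rightarrow> nat \<Rightarrow> nat" where
  "cut_vector n x p =
     (if \<exists>i j. 1 \<le> i \<and> i < j \<and> j \<le> n \<and> p = edge_idx n i j \<and> x i \<noteq> x j then 1 else 0)"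

definition weight :: "nat \<Rightarrow> (nat \<Rightarrow> nat) \<Rightarrow> real \<Rightarrow> real" where
  "weight n \<delta> r = (\<Sum>i = 1..n choose 2. real (\<delta> i) * r ^ ((n choose 2) - i))"

definition prefix_cut :: "nat \<Rightarrow> nat \<Rightarrow> nat \<Rightarrow> nat" where
  "prefix_cut n k = cut_vector n (\<lambda>i. if i \<le> k then 1 else 0)"

definition cut_diff :: "nat \<Rightarrow> nat \<Rightarrow> real \<Rightarrow> real" where
  "cut_diff n k r = weight n (prefix_cut n k) r - weight n (prefix_cut n (k + 1)) r"

text \<open>Meaningful for \<open>6 \<le> n\<close> and \<open>1 \<le> k \<le> n div 2 - 1\<close>, where the root in \<open>(1, 2)\<close> exists and is
  unique.\<close>

definition threshold :: "nat \<Rightarrow> nat \<Rightarrow> real" where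
  "threshold n k = (THE r. 1 < r \<and> r < 2 \<and> cut_diff n k r = 0)"

end

theory Submission
  imports Defs
begin

text \<open>Put \<open>m = n - k - 1\<close>. Up to the factor \<open>r ^ (m choose 2)\<close>, the polynomial \<open>P\<^sup>n\<^sup>,\<^sup>k\<close> is
  \<open>Q\<^sub>m\<^sub>,\<^sub>k(r) = (\<Sum>s=1..k. r ^ ((s + 1) * m + (s choose 2))) - (\<Sum>t<m. r ^ t)\<close>. Every positive term
  has degree at least \<open>m\<close> and every negative term has smaller degree, so \<open>Q\<^sub>m\<^sub>,\<^sub>k\<close> changes sign once.
  Passing from \<open>k\<close> to \<open>k + 1\<close> replaces \<open>m\<close> by \<open>m - 1\<close>; the positive term \<open>s + 1\<close> of the new polynomial
  is \<open>r ^ (m - 2)\<close> times the old term \<open>s\<close>, while the negative part loses \<open>r ^ (m - 1)\<close>. Hence the new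
  polynomial is positive at the old root. For fixed \<open>r > 1\<close> the term \<open>r ^ (2 * m)\<close> alone exceeds
  \<open>(r ^ m - 1) / (r - 1)\<close> when \<open>m\<close> is large, which gives the limit.\<close>

section \<open>Edge positions and exponents\<close>

lemma choose_two_add: "(a + b) choose 2 = (a choose 2) + (b choose 2) + a * b"
  by (induction b) (simp_all add: numeral_2_eq_2)

lemma double_choose_two: "2 * (n choose 2) = n * (n - 1)"
  by (cases n) (simp_all add: choose_two)

text \<open>The exponent counts the edges after \<open>(i, j)\<close>: \<open>n - j\<close> share
  the first endpoint \<open>i\<close>, and \<open>(n - i) choose 2\<close> have both endpoints above
  \<open>i\<close>. The additive form avoids truncated subtraction.\<close>

lemma edge_idx_eq:
  assumes "1 \<le> i" "i < j" "j \<le> n"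
  shows "edge_idx n i j + ((n - j) + ((n - i) choose 2)) = n choose 2"
proof -
  obtain a where i: "i = Suc a" using assms(1) by (cases i) auto
  obtain d where n: "n = i + d" using assms by (metis le_add_diff_inverse less_imp_le order_trans)
  have dbl: "a * i = 2 * (i choose 2)" using double_choose_two[of i] i by simp
  have "(i - 1) * n = 2 * (i choose 2) + a * d"
    using dbl by (simp add: n i algebra_simps)
  then have "edge_idx n i j = (i choose 2) + a * d + (j - i)"
    by (simp add: edge_idx_def)
  moreover have "n choose 2 = (i choose 2) + (d choose 2) + i * d"
    unfolding n by (rule choose_two_add)
  ultimately show ?thesis using assms n i by simp
qed

text \<open>With \<open>b = n - i'\<close>, the left side is below
  \<open>b + (b choose 2) = (b + 1) choose 2\<close>, which is at most
  \<open>(n - i) choose 2\<close>, whatever \<open>j\<close> is.\<close>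

lemma edge_exponent_less:
  fixes n i j i' j' :: nat
  assumes "i < i'" "i' < j'" "j' \<le> n"
  shows "(n - j') + ((n - i') choose 2) < (n - j) + ((n - i) choose 2)"
proof -
  define b where "b = n - i'"
  obtain c where c: "n - i = b + Suc c"
    using assms unfolding b_def
    by (metis add_Suc_right diff_less_mono2 less_iff_Suc_add less_trans order_less_le_trans)
  have "b \<le> b * Suc c" by simp
  moreover have "n - j' < b" using assms by (simp add: b_def)
  ultimately have "(n - j') + (b choose 2) < (b + Suc c) choose 2"
    unfolding choose_two_add[of b "Suc c"] by linarith
  then show ?thesis using c by (simp add: b_def)
qed

lemma inj_on_edge_idx:
  "inj_on (\<lambda>(i, j). edge_idx n i j) {(i, j). 1 \<le> i \<and> i < j \<and> j \<le> n}"
proof (rule inj_onI, clarsimp)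
  fix i j i' j'
  assume A: "Suc 0 \<le> i" "i < j" "j \<le> n" "Suc 0 \<le> i'" "i' < j'" "j' \<le> n"
    and eq: "edge_idx n i j = edge_idx n i' j'"
  have e: "(n - j) + ((n - i) choose 2) = (n - j') + ((n - i') choose 2)"
    using edge_idx_eq[of i j n] edge_idx_eq[of i' j' n] A eq by simp
  have "i = i'"
    using edge_exponent_less[of i i' j' n j] edge_exponent_less[of i' i j n j'] A e
    by (metis less_irrefl linorder_neqE_nat)
  with e A show "i = i' \<and> j = j'" by auto
qed

lemma weight_cut_vector:
  "weight n (cut_vector n x) r =
     (\<Sum>(i, j) | 1 \<le> i \<and> i < j \<and> j \<le> n \<and> x i \<noteq> x j. r ^ ((n - j) + ((n - i) choose 2)))"
proof -
  let ?S = "{(i, j). 1 \<le> i \<and> i < j \<and> j \<le> n \<and> x i \<noteq> x j}"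
  let ?g = "\<lambda>(i, j). edge_idx n i j"
  have range: "?g ` ?S \<subseteq> {1..n choose 2}"
  proof clarify
    fix i j assume A: "1 \<le> i" "i < j" "j \<le> n"
    have "1 \<le> edge_idx n i j" using A by (simp add: edge_idx_def)
    then show "edge_idx n i j \<in> {1..n choose 2}"
      using edge_idx_eq[OF A] by simp
  qed
  have inj: "inj_on ?g ?S"
    by (rule inj_on_subset[OF inj_on_edge_idx]) auto
  have cv: "cut_vector n x p = (if p \<in> ?g ` ?S then 1 else 0)" for p
    by (auto simp: cut_vector_def image_iff)
  have "weight n (cut_vector n x) r = (\<Sum>p\<in>?g ` ?S. r ^ ((n choose 2) - p))"
    unfolding weight_def
    by (rule sum.mono_neutral_cong_right) (use range in \<open>auto simp: cv\<close>)
  also have "\<dots> = (\<Sum>e\<in>?S. r ^ ((n choose 2) - ?g e))"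
    by (rule sum.reindex[OF inj, unfolded o_def])
  also have "\<dots> = (\<Sum>(i, j)\<in>?S. r ^ ((n - j) + ((n - i) choose 2)))"
  proof (rule sum.cong[OF refl], clarify)
    fix i j assume A: "1 \<le> i" "i < j" "j \<le> n"
    show "r ^ ((n choose 2) - edge_idx n i j) = r ^ ((n - j) + ((n - i) choose 2))"
      using edge_idx_eq[OF A] by (metis diff_add_inverse)
  qed
  finally show ?thesis .
qed

text \<open>Vertex \<open>k + 1\<close> changes sides. Edges from \<open>{1..k}\<close> to
  \<open>{k + 2..n}\<close> lie in both cuts and cancel; only edges at \<open>k + 1\<close> remain,
  those to earlier vertices positive, those to later ones negative.\<close>

lemma cut_diff_eq_edge_sums:
  assumes "k < n"
  shows "cut_diff n k r =
           (\<Sum>i = 1..k. r ^ ((n - (k + 1)) + ((n - i) choose 2)))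
         - (\<Sum>j = k + 2..n. r ^ ((n - j) + ((n - (k + 1)) choose 2)))"
proof -
  let ?f = "\<lambda>(i, j). r ^ ((n - j) + ((n - i) choose 2))"
  let ?A = "(\<lambda>i. (i, k + 1)) ` {1..k}"
  let ?B = "(\<lambda>j. (k + 1, j)) ` {k + 2..n}"
  let ?I = "{1..k} \<times> {k + 2..n}"
  have cut: "weight n (prefix_cut n l) r = sum ?f ({1..l} \<times> {l + 1..n})" for l
    unfolding prefix_cut_def weight_cut_vector by (rule sum.cong) (auto split: if_splits)
  have "{1..k} \<times> {k + 1..n} = ?I \<union> ?A" using assms by auto
  then have "weight n (prefix_cut n k) r = sum ?f ?I + sum ?f ?A"
    by (simp only: cut) (rule sum.union_disjoint, auto)
  moreover have "{1..k + 1} \<times> {k + 1 + 1..n} = ?I \<union> ?B" by auto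
  then have "weight n (prefix_cut n (k + 1)) r = sum ?f ?I + sum ?f ?B"
    by (simp only: cut) (rule sum.union_disjoint, auto)
  moreover have "sum ?f ?A = (\<Sum>i = 1..k. r ^ ((n - (k + 1)) + ((n - i) choose 2)))"
    by (subst sum.reindex) (auto simp: inj_on_def)
  moreover have "sum ?f ?B = (\<Sum>j = k + 2..n. r ^ ((n - j) + ((n - (k + 1)) choose 2)))"
    by (subst sum.reindex) (auto simp: inj_on_def)
  ultimately show ?thesis by (simp add: cut_diff_def)
qed

section \<open>The reduced polynomial and its root\<close>

definition reduced_diff :: "nat \<Rightarrow> nat \<Rightarrow> real \<Rightarrow> real" where
  "reduced_diff m k r = (\<Sum>s = 1..k. r ^ ((s + 1) * m + (s choose 2))) - (\<Sum>t<m. r ^ t)"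

lemma cut_diff_eq_reduced_diff:
  assumes "n = m + k + 1"
  shows "cut_diff n k r = r ^ (m choose 2) * reduced_diff m k r"
proof -
  have pos: "(\<Sum>i = 1..k. r ^ ((n - (k + 1)) + ((n - i) choose 2))) =
        (\<Sum>s = 1..k. r ^ (m choose 2) * r ^ ((s + 1) * m + (s choose 2)))"
  \<comment> \<open>Here \<open>s = k + 1 - i\<close>, so \<open>n - i = m + s\<close>; the cross
    term \<open>m * s\<close> of \<open>(m + s) choose 2\<close> and the extra \<open>m\<close> give
    \<open>(s + 1) * m\<close>.\<close>
  proof (rule sum.reindex_bij_witness[of _ "\<lambda>s. k + 1 - s" "\<lambda>i. k + 1 - i"])
    fix i assume i: "i \<in> {1..k}"
    then have "n - i = m + (k + 1 - i)" using assms by auto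
    then show "r ^ (m choose 2) * r ^ ((k + 1 - i + 1) * m + ((k + 1 - i) choose 2)) =
        r ^ ((n - (k + 1)) + ((n - i) choose 2))"
      using assms by (simp only: choose_two_add power_add[symmetric]) (simp add: algebra_simps)
  qed auto
  have neg: "(\<Sum>j = k + 2..n. r ^ ((n - j) + ((n - (k + 1)) choose 2))) =
        (\<Sum>t<m. r ^ (m choose 2) * r ^ t)"
    by (rule sum.reindex_bij_witness[of _ "\<lambda>t. n - t" "\<lambda>j. n - j"])
      (use assms in \<open>auto simp: power_add[symmetric] add.commute\<close>)
  have "k < n" using assms by simp
  then show ?thesis
    unfolding cut_diff_eq_edge_sums[OF \<open>k < n\<close>] pos neg reduced_diff_def
    by (simp add: sum_distrib_left right_diff_distrib)
qed

text \<open>Scaling \<open>r\<close> by \<open>c\<close> multiplies a term of degree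
  \<open>d\<close> by \<open>c ^ d\<close>: at least \<open>c ^ m\<close> for positive terms, less
  for negative ones. This makes the single sign change quantitative.\<close>

lemma reduced_diff_scale:
  assumes "1 < c" "0 < r" "0 < m"
  shows "c ^ m * reduced_diff m k r < reduced_diff m k (c * r)"
proof -
  have "(\<Sum>s = 1..k. c ^ m * r ^ ((s + 1) * m + (s choose 2)))
      \<le> (\<Sum>s = 1..k. (c * r) ^ ((s + 1) * m + (s choose 2)))"
    using assms by (intro sum_mono) (auto simp: power_mult_distrib intro!: power_increasing)
  moreover have "(\<Sum>t<m. (c * r) ^ t) < (\<Sum>t<m. c ^ m * r ^ t)"
    using assms by (intro sum_strict_mono) (auto simp: power_mult_distrib)
  ultimately show ?thesis
    by (simp add: reduced_diff_def right_diff_distrib sum_distrib_left)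
qed

lemma reduced_diff_pos_mono:
  assumes "0 \<le> reduced_diff m k r" "0 < r" "r < r'" "0 < m"
  shows "0 < reduced_diff m k r'"
proof -
  have "0 \<le> (r' / r) ^ m * reduced_diff m k r" using assms by simp
  also have "\<dots> < reduced_diff m k (r' / r * r)"
    using assms by (intro reduced_diff_scale) auto
  finally show ?thesis using assms by simp
qed

lemma reduced_diff_ge:
  assumes "1 < r" "1 \<le> k"
  shows "r ^ (2 * m) - (r ^ m - 1) / (r - 1) \<le> reduced_diff m k r"
proof -
  have "(\<Sum>s\<in>{1}. r ^ ((s + 1) * m + (s choose 2)))
      \<le> (\<Sum>s = 1..k. r ^ ((s + 1) * m + (s choose 2)))"
    using assms by (intro sum_mono2) auto
  then show ?thesis
    using assms by (simp add: reduced_diff_def geometric_sum binomial_eq_0 mult_2)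
qed

text \<open>\<open>k < m\<close> says \<open>k + 1 \<le> n div 2\<close> and makes the value at 1,
  \<open>k - m\<close>, negative. Existence is by intermediate values, uniqueness by
  \<open>reduced_diff_pos_mono\<close>.\<close>

lemma threshold_root:
  assumes "n = m + k + 1" "1 \<le> k" "k < m"
  shows "1 < threshold n k" "threshold n k < 2" "reduced_diff m k (threshold n k) = 0"
proof -
  let ?Q = "reduced_diff m k"
  have "?Q 1 < 0" using assms by (simp add: reduced_diff_def)
  have "(2::real) ^ m \<le> 2 ^ (2 * m)" by (rule power_increasing) auto
  moreover have "2 ^ (2 * m) - (2 ^ m - 1) \<le> ?Q 2"
    using reduced_diff_ge[of 2 k m] assms by simp
  ultimately have "0 < ?Q 2" by linarith
  have "continuous_on {1..2} ?Q"
    unfolding reduced_diff_def by (intro continuous_intros)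
  then obtain x where x: "1 \<le> x" "x \<le> 2" "?Q x = 0"
    using IVT'[of ?Q 1 0 2] \<open>?Q 1 < 0\<close> \<open>0 < ?Q 2\<close> by auto
  have eq0: "cut_diff n k r = 0 \<longleftrightarrow> ?Q r = 0" if "1 < r" for r
    using that by (simp add: cut_diff_eq_reduced_diff[OF assms(1)])
  have "x \<noteq> 1" "x \<noteq> 2" using x \<open>?Q 1 < 0\<close> \<open>0 < ?Q 2\<close> by auto
  with x have x': "1 < x" "x < 2" by auto
  have "threshold n k = x"
    unfolding threshold_def
  proof (rule the_equality)
    show "1 < x \<and> x < 2 \<and> cut_diff n k x = 0" using x x' eq0 by auto
    fix r assume r: "1 < r \<and> r < 2 \<and> cut_diff n k r = 0"
    then show "r = x"
      using reduced_diff_pos_mono[of m k r x] reduced_diff_pos_mono[of m k x r] x x' eq0[of r] assms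
      by (cases r x rule: linorder_cases) auto
  qed
  with x x' show "1 < threshold n k" "threshold n k < 2" "?Q (threshold n k) = 0" by auto
qed

lemma threshold_less:
  assumes "n = m + k + 1" "1 \<le> k" "k < m" "1 < r" "0 < reduced_diff m k r"
  shows "threshold n k < r"
  using reduced_diff_pos_mono[of m k r "threshold n k"] threshold_root[OF assms(1-3)] assms
  by (cases "threshold n k" r rule: linorder_cases) auto

section \<open>Decrease in \<open>k\<close> and the limit\<close>

lemma reduced_diff_Suc_pos:
  assumes "0 < m" "1 < r" "reduced_diff (m + 1) k r = 0"
  shows "0 < reduced_diff m (k + 1) r"
proof -
  let ?A = "\<Sum>s = 1..k. r ^ ((s + 1) * (m + 1) + (s choose 2))"
  have shift: "sum g {1..k + 1} = g 1 + (\<Sum>s = 1..k. g (s + 1))" for g :: "nat \<Rightarrow> real"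
    using sum.atLeast_Suc_atMost[of 1 "k + 1" g] sum.shift_bounds_cl_Suc_ivl[of g 1 k] by simp
  have "(\<Sum>s = 1..k + 1. r ^ ((s + 1) * m + (s choose 2))) =
      r ^ (2 * m) + (\<Sum>s = 1..k. r ^ ((s + 2) * m + ((s + 1) choose 2)))"
    unfolding shift by (simp add: binomial_eq_0 mult_2)
  \<comment> \<open>Since \<open>(s + 1) choose 2 = (s choose 2) + s\<close>, the two exponents
    differ by exactly \<open>m - 1\<close>.\<close>
  also have "(\<Sum>s = 1..k. r ^ ((s + 2) * m + ((s + 1) choose 2))) = r ^ (m - 1) * ?A"
  proof -
    obtain l where l: "m = Suc l" using assms by (cases m) auto
    show ?thesis
      unfolding sum_distrib_left power_add[symmetric] choose_two_add
      by (intro sum.cong refl arg_cong[of _ _ "\<lambda>e. r ^ e"]) (simp add: l algebra_simps)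
  qed
  finally have eq: "(\<Sum>s = 1..k + 1. r ^ ((s + 1) * m + (s choose 2))) = r ^ (2 * m) + r ^ (m - 1) * ?A" .
  \<comment> \<open>At the old root, \<open>?A\<close> equals the old negative part, which is the
    new one plus \<open>r ^ m\<close>.\<close>
  have A: "?A = (\<Sum>t<m. r ^ t) + r ^ m"
    using assms(3) by (simp add: reduced_diff_def)
  have "1 \<le> r ^ (m - 1)" using assms by simp
  moreover have "0 \<le> ?A" using assms by (intro sum_nonneg) auto
  ultimately have "?A \<le> r ^ (m - 1) * ?A" by (simp add: mult_le_cancel_right1)
  moreover have "0 < r ^ (2 * m)" "0 < r ^ m" using assms by auto
  ultimately show ?thesis
    unfolding reduced_diff_def eq using A by linarith
qed

lemma threshold_strict_decreasing:
  assumes "6 \<le> n" "1 \<le> k" "k \<le> n div 2 - 2"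
  shows "threshold n (k + 1) < threshold n k"
proof -
  \<comment> \<open>This is the parameter belonging to \<open>k + 1\<close>; \<open>k\<close> itself
    has \<open>m + 1\<close>.\<close>
  define m where "m = n - k - 2"
  have n: "n = (m + 1) + k + 1" "n = m + (k + 1) + 1" and lt: "k + 1 < m"
    using assms by (auto simp: m_def)
  have root: "1 < threshold n k" "reduced_diff (m + 1) k (threshold n k) = 0"
    using threshold_root[OF n(1)] assms lt by auto
  show ?thesis
    by (rule threshold_less[OF n(2)]) (use root lt reduced_diff_Suc_pos in auto)
qed

lemma threshold_tendsto_one:
  assumes "1 \<le> k"
  shows "(\<lambda>n. threshold n k) \<longlonglongrightarrow> 1"
proof (rule order_tendstoI)
  \<comment> \<open>Writing \<open>n = m + k + 1\<close> with \<open>m > k\<close> excludes only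
    finitely many \<open>n\<close>, those where \<open>threshold\<close> need not be a root.\<close>
  have ev: "\<forall>\<^sub>F n in sequentially. P n" if "\<forall>\<^sub>F m in sequentially. P (m + k + 1)" for P
    using that eventually_sequentially_seg[of P "k + 1"] by (simp add: add.assoc)
  fix a :: real assume "a < 1"
  have "\<forall>\<^sub>F m in sequentially. a < threshold (m + k + 1) k"
    using eventually_gt_at_top[of k]
    by eventually_elim (use threshold_root(1)[OF refl assms] \<open>a < 1\<close> in force)
  then show "\<forall>\<^sub>F n in sequentially. a < threshold n k" by (rule ev)
next
  have ev: "\<forall>\<^sub>F n in sequentially. P n" if "\<forall>\<^sub>F m in sequentially. P (m + k + 1)" for P
    using that eventually_sequentially_seg[of P "k + 1"] by (simp add: add.assoc)
  fix r :: real assume r: "1 < r"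
  \<comment> \<open>Beyond \<open>M\<close>,
    \<open>(r ^ m - 1) / (r - 1) < r ^ m / (r - 1) < r ^ (2 * m)\<close>.\<close>
  obtain M where M: "1 / (r - 1) < r ^ M"
    using real_arch_pow[OF r] by blast
  have "\<forall>\<^sub>F m in sequentially. 1 / (r - 1) < r ^ m"
    using eventually_ge_at_top[of M]
  proof eventually_elim
    case (elim m)
    have "r ^ M \<le> r ^ m" using elim r by (intro power_increasing) auto
    with M show ?case by linarith
  qed
  then have "\<forall>\<^sub>F m in sequentially. threshold (m + k + 1) k < r"
    using eventually_gt_at_top[of k]
  proof eventually_elim
    case (elim m)
    have "(r ^ m - 1) / (r - 1) < r ^ m * (1 / (r - 1))" using r by (simp add: divide_strict_right_mono)
    also have "\<dots> < r ^ m * r ^ m" using elim r by (intro mult_strict_left_mono) auto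
    also have "\<dots> = r ^ (2 * m)" by (simp add: mult_2 power_add)
    finally have "0 < reduced_diff m k r" using reduced_diff_ge[OF r assms, of m] by linarith
    then show ?case using threshold_less[OF refl assms] elim r by blast
  qed
  then show "\<forall>\<^sub>F n in sequentially. threshold n k < r" by (rule ev)
qed

theorem mainTheorem9:
  shows "(\<forall>n k :: nat. 6 \<le> n \<longrightarrow> 1 \<le> k \<longrightarrow> k \<le> n div 2 - 2 \<longrightarrow>
            threshold n (k + 1) < threshold n k)
       \<and> (\<forall>k :: nat. 1 \<le> k \<longrightarrow> (\<lambda>n. threshold n k) \<longlonglongrightarrow> 1)"
  using threshold_strict_decreasing threshold_tendsto_one by blast

end
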